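(* Let $\mathbf{F}_t=h(u,v)\,\nabla u\times\nabla v$ be an electromagnetic field obtained from Bateman's construction with the projection maps $$u=\frac{x^2+y^2+z^2-t^2-1+2\mathrm{i}z}{x^2+y^2+z^2-(t-\mathrm{i})^2},\qquad v=\frac{2(x-\mathrm{i}y)}{x^2+y^2+z^2-(t-\mathrm{i})^2}.$$ Then, for all $t\in\mathbb{R}$, every knotted (closed) field line of the electric field $\mathrm{Re}(\mathbf{F}_t)$ or of the magnetic field $\mathrm{Im}(\mathbf{F}_t)$ is Legendrian with respect to the contact structure $$\xi_t=\mathrm{span}\{\mathrm{Re}(\nabla u\times\nabla v),\,\mathrm{Im}(\nabla u\times\nabla v)\}$$ on $\mathbb{R}^3$.
   Context: Here $(x,y,z)\in\mathbb{R}^3$ are spatial coordinates, $t\in\mathbb{R}$ is time, and $\nabla$ is the gradient with respect to $(x,y,z)$ applied to complex-valued functions. For each $t$, the map $(u,v)$ is an inverse stereographic projection from $\mathbb{R}^3\cup\{\infty\}$ to $S^3=\{(u,v)\in\mathbb{C}^2:|u|^2+|v|^2=1\}$. Bateman's construction: for holomorphic functions $f,g$ of $(u,v)$, one sets $\mathbf{F}_t=\mathbf{E}_t+\mathrm{i}\mathbf{B}_t=\nabla f(u,v)\times\nabla g(u,v)=h(u,v)\,\nabla u\times\nabla v$ with $h=\partial_uf\,\partial_vg-\partial_vf\,\partial_ug$ holomorphic; $\mathbf{E}_t$ is the electric field and $\mathbf{B}_t$ the magnetic field. A field line is an integral curve of the vector field in question. For every $t$ the two real vector fields $\mathrm{Re}(\nabla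 u\times\nabla v)$ and $\mathrm{Im}(\nabla u\times\nabla v)$ are linearly independent at every point of $\mathbb{R}^3$, and the plane field $\xi_t$ they span is a contact structure, i.e. $\xi_t=\ker\alpha_t$ for a 1-form $\alpha_t$ with $\alpha_t\wedge\mathrm{d}\alpha_t\neq0$ everywhere. A curve is Legendrian with respect to $\xi_t$ if its tangent vector lies in $\xi_t$ at every point. *)

theory Defs
  imports "HOL-Analysis.Analysis"
begin

definition cgrad :: "(real^3 \<Rightarrow> complex) \<Rightarrow> real^3 \<Rightarrow> complex^3" where
  "cgrad \<phi> p = (\<chi> i. frechet_derivative \<phi> (at p) (axis i 1))"

definition ccross :: "complex^3 \<Rightarrow> complex^3 \<Rightarrow> complex^3" where
  "ccross A B = vector [A$2 * B$3 - A$3 * B$2, A$3 * B$1 - A$1 * B$3, A$1 * B$2 - A$2 * B$1]"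

definition re_vec :: "complex^3 \<Rightarrow> real^3" where
  "re_vec A = (\<chi> i. Re (A$i))"

definition im_vec :: "complex^3 \<Rightarrow> real^3" where
  "im_vec A = (\<chi> i. Im (A$i))"

definition proj_u :: "real \<Rightarrow> real^3 \<Rightarrow> complex" where
  "proj_u t p =
     (complex_of_real ((p$1)\<^sup>2 + (p$2)\<^sup>2 + (p$3)\<^sup>2 - t\<^sup>2 - 1) + 2 * \<i> * complex_of_real (p$3)) /
     (complex_of_real ((p$1)\<^sup>2 + (p$2)\<^sup>2 + (p$3)\<^sup>2) - (complex_of_real t - \<i>)\<^sup>2)"

definition proj_v :: "real \<Rightarrow> real^3 \<Rightarrow> complex" where
  "proj_v t p =
     2 * (complex_of_real (p$1) - \<i> * complex_of_real (p$2)) /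
     (complex_of_real ((p$1)\<^sup>2 + (p$2)\<^sup>2 + (p$3)\<^sup>2) - (complex_of_real t - \<i>)\<^sup>2)"

text \<open>Holomorphy in two variables on an open set: the real total derivative exists and is
  complex linear.\<close>

definition holomorphic2_on :: "(complex \<times> complex \<Rightarrow> complex) \<Rightarrow> (complex \<times> complex) set \<Rightarrow> bool" where
  "holomorphic2_on f U \<longleftrightarrow>
     (\<forall>w\<in>U. \<exists>a b. (f has_derivative (\<lambda>(x, y). a * x + b * y)) (at w))"

definition partial_u :: "(complex \<times> complex \<Rightarrow> complex) \<Rightarrow> complex \<times> complex \<Rightarrow> complex" where
  "partial_u f w = deriv (\<lambda>a. f (a, snd w)) (fst w)"

definition partial_v :: "(complex \<times> complex \<Rightarrow> complex) \<Rightarrow> complex \<times> complex \<Rightarrow> complex" where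
  "partial_v f w = deriv (\<lambda>b. f (fst w, b)) (snd w)"

definition bateman_h ::
    "(complex \<times> complex \<Rightarrow> complex) \<Rightarrow> (complex \<times> complex \<Rightarrow> complex) \<Rightarrow> complex \<times> complex \<Rightarrow> complex" where
  "bateman_h f g w = partial_u f w * partial_v g w - partial_v f w * partial_u g w"

definition bateman_field ::
    "(complex \<times> complex \<Rightarrow> complex) \<Rightarrow> (complex \<times> complex \<Rightarrow> complex) \<Rightarrow> real \<Rightarrow> real^3 \<Rightarrow> complex^3" where
  "bateman_field f g t p =
     ccross (cgrad (\<lambda>q. f (proj_u t q, proj_v t q)) p) (cgrad (\<lambda>q. g (proj_u t q, proj_v t q)) p)"

definition hopf_field :: "real \<Rightarrow> real^3 \<Rightarrow> complex^3" where
  "hopf_field t p = ccross (cgrad (proj_u t) p) (cgrad (proj_v t) p)"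

definition xi :: "real \<Rightarrow> real^3 \<Rightarrow> (real^3) set" where
  "xi t p = span {re_vec (hopf_field t p), im_vec (hopf_field t p)}"

primrec C_k :: "nat \<Rightarrow> (real^3 \<Rightarrow> 'b::real_normed_vector) \<Rightarrow> bool" where
  "C_k 0 f \<longleftrightarrow> continuous_on UNIV f"
| "C_k (Suc k) f \<longleftrightarrow>
     (\<forall>p. f differentiable (at p)) \<and> (\<forall>X. C_k k (\<lambda>p. frechet_derivative f (at p) X))"

definition smooth :: "(real^3 \<Rightarrow> 'b::real_normed_vector) \<Rightarrow> bool" where
  "smooth f \<longleftrightarrow> (\<forall>k. C_k k f)"

type_synonym one_form = "real^3 \<Rightarrow> ((real^3) \<Rightarrow>\<^sub>L real)"

definition ext_deriv :: "one_form \<Rightarrow> real^3 \<Rightarrow> real^3 \<Rightarrow> real^3 \<Rightarrow> real" where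
  "ext_deriv \<alpha> p X Y =
     blinfun_apply (frechet_derivative \<alpha> (at p) X) Y - blinfun_apply (frechet_derivative \<alpha> (at p) Y) X"

definition wedge12 ::
    "(real^3 \<Rightarrow> real) \<Rightarrow> (real^3 \<Rightarrow> real^3 \<Rightarrow> real) \<Rightarrow> real^3 \<Rightarrow> real^3 \<Rightarrow> real^3 \<Rightarrow> real" where
  "wedge12 a b X Y Z = a X * b Y Z + a Y * b Z X + a Z * b X Y"

definition contact_structure :: "(real^3 \<Rightarrow> (real^3) set) \<Rightarrow> bool" where
  "contact_structure \<xi> \<longleftrightarrow>
     (\<exists>\<alpha>::one_form. smooth \<alpha> \<and>
        (\<forall>p. \<xi> p = {X. blinfun_apply (\<alpha> p) X = 0}) \<and>
        (\<forall>p. wedge12 (blinfun_apply (\<alpha> p)) (ext_deriv \<alpha> p) \<noteq> (\<lambda>X Y Z. 0)))"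

definition legendrian :: "(real^3 \<Rightarrow> (real^3) set) \<Rightarrow> (real \<Rightarrow> real^3) \<Rightarrow> bool" where
  "legendrian \<xi> \<gamma> \<longleftrightarrow>
     (\<forall>s. \<gamma> differentiable (at s) \<and> vector_derivative \<gamma> (at s) \<in> \<xi> (\<gamma> s))"

definition field_line :: "(real^3 \<Rightarrow> real^3) \<Rightarrow> (real \<Rightarrow> real^3) \<Rightarrow> bool" where
  "field_line V \<gamma> \<longleftrightarrow> (\<forall>s. (\<gamma> has_vector_derivative V (\<gamma> s)) (at s))"

text \<open>A closed integral curve is parametrised periodically over the whole line. Constant curves
  at zeros of the field are excluded; for a locally Lipschitz field, uniqueness of solutions then
  makes the image an embedded circle, i.e. a knot (possibly trivial).\<close>

definition closed_field_line :: "(real^3 \<Rightarrow> real^3) \<Rightarrow> (real \<Rightarrow> real^3) \<Rightarrow> bool" where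
  "closed_field_line V \<gamma> \<longleftrightarrow>
     field_line V \<gamma> \<and> (\<exists>T>0. \<forall>s. \<gamma> (s + T) = \<gamma> s) \<and> \<not> \<gamma> constant_on UNIV"

end

theory Submission
  imports Defs
begin

text \<open>Put $s = x - iy$, $w = z - t + i$ and let $A$ be the common denominator of $u$ and $v$, so that
  $u = 1 + 2iw/A$ and $v = 2s/A$. Then
  $\nabla u \times \nabla v = \frac{4i}{A^3}\,(i(s^2 - w^2),\, -(s^2 + w^2),\, 2isw)$,
  an isotropic vector that never vanishes. Its real and imaginary parts therefore span the plane
  orthogonal to the real vector $(2\,\mathrm{Re}(\bar s w),\, 2\,\mathrm{Im}(\bar s w),\, |w|^2 - |s|^2)$,
  whose dual 1-form is polynomial and satisfies
  $\alpha \wedge d\alpha = 4(x^2 + y^2 + (z-t)^2 + 1)\,dx \wedge dy \wedge dz$.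
  Multiplying by the complex number $h$ does not leave the complex line of $\nabla u \times \nabla v$, so both
  fields are tangent to $\xi_t$.\<close>

section \<open>Smooth maps\<close>

lemma C_k_Suc_imp: "C_k (Suc k) f \<Longrightarrow> C_k k f"
proof (induction k arbitrary: f)
  case 0
  then show ?case
    by (auto simp: continuous_on_eq_continuous_at intro: differentiable_imp_continuous_within)
next
  case (Suc k)
  from Suc.prems have "f differentiable (at p)" and "C_k (Suc k) (\<lambda>p. frechet_derivative f (at p) X)" for p X
    by simp_all
  then show ?case
    using Suc.IH by simp
qed

lemma C_k_const: "C_k k (\<lambda>p. c)"
  by (induction k arbitrary: c) (auto simp: frechet_derivative_const)

lemma C_k_add: "C_k k f \<Longrightarrow> C_k k g \<Longrightarrow> C_k k (\<lambda>p. f p + g p)"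
proof (induction k arbitrary: f g)
  case 0
  then show ?case by (auto intro: continuous_intros)
next
  case (Suc k)
  then have df: "f differentiable (at p)" and dg: "g differentiable (at p)" for p
    by simp_all
  have "frechet_derivative (\<lambda>p. f p + g p) (at p) =
      (\<lambda>X. frechet_derivative f (at p) X + frechet_derivative g (at p) X)" for p
    by (rule frechet_derivative_at[symmetric])
      (intro has_derivative_add df[unfolded frechet_derivative_works] dg[unfolded frechet_derivative_works])
  then show ?case
    using Suc by (auto intro: differentiable_add)
qed

lemma C_k_scaleR: "C_k k f \<Longrightarrow> C_k k g \<Longrightarrow> C_k k (\<lambda>p. f p *\<^sub>R g p)"
proof (induction k arbitrary: f g)
  case 0
  then show ?case by (auto intro: continuous_intros)
next
  case (Suc k)
  then have df: "f differentiable (at p)" and dg: "g differentiable (at p)" for p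
    by simp_all
  have "frechet_derivative (\<lambda>p. f p *\<^sub>R g p) (at p) =
      (\<lambda>X. f p *\<^sub>R frechet_derivative g (at p) X + frechet_derivative f (at p) X *\<^sub>R g p)" for p
    by (rule frechet_derivative_at[symmetric])
      (intro has_derivative_scaleR df[unfolded frechet_derivative_works] dg[unfolded frechet_derivative_works])
  \<comment> \<open>The product rule leaves one factor undifferentiated in each term, so the
    induction hypothesis at level \<open>k\<close> is also needed for \<open>f\<close> and
    \<open>g\<close> themselves.\<close>
  moreover have "C_k k f" "C_k k g"
    using Suc.prems C_k_Suc_imp by blast+
  ultimately show ?case
    using Suc by (auto intro: C_k_add differentiable_scaleR)
qed

lemma C_k_compose_bounded_linear:
  "bounded_linear L \<Longrightarrow> C_k k f \<Longrightarrow> C_k k (\<lambda>p. L (f p))"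
proof (induction k arbitrary: f)
  case 0
  then show ?case by (auto intro: linear_continuous_on bounded_linear.continuous_on)
next
  case (Suc k)
  then have df: "f differentiable (at p)" for p
    by simp
  have der: "((\<lambda>p. L (f p)) has_derivative (\<lambda>X. L (frechet_derivative f (at p) X))) (at p)" for p
    by (rule bounded_linear.has_derivative[OF Suc.prems(1) df[unfolded frechet_derivative_works]])
  then have "frechet_derivative (\<lambda>p. L (f p)) (at p) = (\<lambda>X. L (frechet_derivative f (at p) X))" for p
    by (metis frechet_derivative_at)
  then show ?case
    using Suc der by (auto simp: differentiable_def)
qed

lemma C_k_bounded_linear:
  fixes L :: "real^3 \<Rightarrow> 'b::real_normed_vector"
  assumes "bounded_linear L" shows "C_k k L"
proof (cases k)
  case 0
  then show ?thesis using assms by (simp add: linear_continuous_on)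
next
  case (Suc j)
  have "frechet_derivative L (at p) = L" for p
    using bounded_linear_imp_has_derivative[OF assms] by (metis frechet_derivative_at)
  then show ?thesis
    using Suc bounded_linear_imp_has_derivative[OF assms] by (auto simp: differentiable_def C_k_const)
qed

section \<open>The contact form\<close>

text \<open>This is the Hopf map of the pair (s, w) from the overview, in coordinates. The sum of
  \<open>axis\<close> vectors lets smoothness and the derivative be obtained term by term.\<close>

definition contact_normal :: "real \<Rightarrow> real^3 \<Rightarrow> real^3" where
  "contact_normal t p =
     (2 * (p$1 * (p$3 - t) - p$2)) *\<^sub>R axis 1 1 +
     (2 * (p$1 + p$2 * (p$3 - t))) *\<^sub>R axis 2 1 +
     ((p$3 - t)\<^sup>2 + 1 - (p$1)\<^sup>2 - (p$2)\<^sup>2) *\<^sub>R axis 3 1"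

definition contact_form :: "real \<Rightarrow> one_form" where
  "contact_form t p = blinfun_inner_right (contact_normal t p)"

lemma contact_normal_nth [simp]:
  "contact_normal t p $ 1 = 2 * (p$1 * (p$3 - t) - p$2)"
  "contact_normal t p $ 2 = 2 * (p$1 + p$2 * (p$3 - t))"
  "contact_normal t p $ 3 = (p$3 - t)\<^sup>2 + 1 - (p$1)\<^sup>2 - (p$2)\<^sup>2"
  by (simp_all add: contact_normal_def axis_def)

text \<open>The Hopf map squares lengths: the normal has length |s|^2 + |w|^2, which is
  \<open>?r\<close> and is at least 1 because Im w = 1.\<close>

lemma contact_normal_nonzero: "contact_normal t p \<noteq> 0"
proof
  let ?N = "contact_normal t p" and ?r = "(p$3 - t)\<^sup>2 + 1 + (p$1)\<^sup>2 + (p$2)\<^sup>2"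
  have "(?N$1)\<^sup>2 + (?N$2)\<^sup>2 + (?N$3)\<^sup>2 = ?r\<^sup>2"
    by (simp add: power2_eq_square algebra_simps)
  moreover have "?r > 0"
    by (smt (verit) zero_le_power2)
  moreover assume "?N = 0"
  ultimately show False
    by (simp del: contact_normal_nth)
qed

lemma C_k_nth: "C_k k (\<lambda>p::real^3. p $ i)"
  by (rule C_k_bounded_linear) (rule bounded_linear_vec_nth)

lemma C_k_mult:
  fixes f g :: "real^3 \<Rightarrow> real"
  shows "C_k k f \<Longrightarrow> C_k k g \<Longrightarrow> C_k k (\<lambda>p. f p * g p)"
  using C_k_scaleR[of k f g] by simp

lemma C_k_diff: "C_k k f \<Longrightarrow> C_k k g \<Longrightarrow> C_k k (\<lambda>p. f p - g p)"
  using C_k_add[of k f "\<lambda>p. - g p"]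
    C_k_compose_bounded_linear[OF bounded_linear_minus[OF bounded_linear_ident], of k g] by simp

lemma smooth_contact_form: "smooth (contact_form t)"
  unfolding smooth_def contact_form_def contact_normal_def power2_eq_square
  by (intro allI C_k_compose_bounded_linear[OF bounded_linear_blinfun_inner_right]
      C_k_add C_k_scaleR C_k_diff C_k_mult C_k_const C_k_nth)

definition contact_normal_deriv :: "real \<Rightarrow> real^3 \<Rightarrow> real^3 \<Rightarrow> real^3" where
  "contact_normal_deriv t p X =
     (2 * (X$1 * (p$3 - t) + p$1 * X$3 - X$2)) *\<^sub>R axis 1 1 +
     (2 * (X$1 + X$2 * (p$3 - t) + p$2 * X$3)) *\<^sub>R axis 2 1 +
     (2 * ((p$3 - t) * X$3 - p$1 * X$1 - p$2 * X$2)) *\<^sub>R axis 3 1"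

lemma contact_normal_has_derivative:
  "(contact_normal t has_derivative contact_normal_deriv t p) (at p)"
  unfolding contact_normal_def[abs_def] contact_normal_deriv_def[abs_def] power2_eq_square
  by (auto intro!: derivative_eq_intros bounded_linear.has_derivative[OF bounded_linear_vec_nth]
      ext simp: algebra_simps)

text \<open>Passing from a vector to its dual form is bounded linear, so it commutes with
  differentiation.\<close>

lemma ext_deriv_contact_form:
  "ext_deriv (contact_form t) p X Y =
     contact_normal_deriv t p X \<bullet> Y - contact_normal_deriv t p Y \<bullet> X"
proof -
  have "(contact_form t has_derivative (\<lambda>X. blinfun_inner_right (contact_normal_deriv t p X))) (at p)"
    unfolding contact_form_def[abs_def]
    by (rule bounded_linear.has_derivative[OF bounded_linear_blinfun_inner_right contact_normal_has_derivative])
  then have "frechet_derivative (contact_form t) (at p) =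
      (\<lambda>X. blinfun_inner_right (contact_normal_deriv t p X))"
    by (metis frechet_derivative_at)
  then show ?thesis
    by (simp add: ext_deriv_def)
qed

text \<open>The value is N . curl N for the normal N, with curl N = 4(-y, x, 1); the terms in
  xy(z-t) cancel.\<close>

lemma wedge_contact_form:
  "wedge12 (blinfun_apply (contact_form t p)) (ext_deriv (contact_form t) p)
     (axis 1 1) (axis 2 1) (axis 3 1) = 4 * ((p$1)\<^sup>2 + (p$2)\<^sup>2 + (p$3 - t)\<^sup>2 + 1)"
  by (simp add: wedge12_def ext_deriv_contact_form contact_form_def contact_normal_deriv_def
      inner_vec_def sum_3 axis_def) (simp add: power2_eq_square algebra_simps)

section \<open>The Hopf field\<close>

definition denom :: "real \<Rightarrow> real^3 \<Rightarrow> complex" where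
  "denom t p = complex_of_real ((p$1)\<^sup>2 + (p$2)\<^sup>2 + (p$3)\<^sup>2) - (complex_of_real t - \<i>)\<^sup>2"

definition spinor_s :: "real^3 \<Rightarrow> complex" where
  "spinor_s p = complex_of_real (p$1) - \<i> * complex_of_real (p$2)"

definition spinor_w :: "real \<Rightarrow> real^3 \<Rightarrow> complex" where
  "spinor_w t p = complex_of_real (p$3 - t) + \<i>"

text \<open>The imaginary part is 2t, and for t = 0 the real part is |p|^2 + 1.\<close>

lemma denom_nonzero: "denom t p \<noteq> 0"
proof
  assume "denom t p = 0"
  then have "Re (denom t p) = 0" "Im (denom t p) = 0" by simp_all
  then have "t = 0" "(p$1)\<^sup>2 + (p$2)\<^sup>2 + (p$3)\<^sup>2 - t\<^sup>2 + 1 = 0"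
    by (simp_all add: denom_def power2_eq_square)
  then show False
    by (smt (verit) zero_le_power2 power_zero_numeral)
qed

text \<open>Splitting \<open>denom\<close> off the numerator leaves an affine function of
  \<open>p\<close> over \<open>denom\<close>, the same shape as in \<open>proj_v_eq\<close>.\<close>

lemma proj_u_eq: "proj_u t p = 1 + 2 * \<i> * spinor_w t p / denom t p"
proof -
  have "complex_of_real ((p$1)\<^sup>2 + (p$2)\<^sup>2 + (p$3)\<^sup>2 - t\<^sup>2 - 1) + 2 * \<i> * complex_of_real (p$3) =
      denom t p + 2 * \<i> * spinor_w t p"
    by (simp add: complex_eq_iff denom_def spinor_w_def power2_eq_square)
  then have "proj_u t p = (denom t p + 2 * \<i> * spinor_w t p) / denom t p"
    unfolding proj_u_def denom_def[of t p, symmetric] by (rule arg_cong)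
  then show ?thesis
    using denom_nonzero[of t p] by (simp add: add_divide_distrib)
qed

lemma proj_v_eq: "proj_v t p = 2 * spinor_s p / denom t p"
  by (simp add: proj_v_def denom_def spinor_s_def)

lemmas nth_has_derivative [derivative_intros] =
  bounded_linear.has_derivative[OF bounded_linear_vec_nth]

lemma denom_has_derivative:
  "(denom t has_derivative (\<lambda>X. complex_of_real (2 * (p \<bullet> X)))) (at p)"
  unfolding denom_def[abs_def]
  by (auto intro!: derivative_eq_intros ext
      simp: inner_vec_def sum_3 algebra_simps)

lemma proj_u_has_derivative:
  "(proj_u t has_derivative (\<lambda>X. 2 * \<i> / denom t p *
     (complex_of_real (X$3) - 2 * spinor_w t p / denom t p * complex_of_real (p \<bullet> X)))) (at p)"
  unfolding proj_u_eq[abs_def] spinor_w_def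
  by (rule derivative_eq_intros denom_has_derivative denom_nonzero refl)+
    (auto simp: field_simps denom_nonzero)

lemma proj_v_has_derivative:
  "(proj_v t has_derivative (\<lambda>X. 2 / denom t p *
     (spinor_s X - 2 * spinor_s p / denom t p * complex_of_real (p \<bullet> X)))) (at p)"
  unfolding proj_v_eq[abs_def] spinor_s_def
  by (rule derivative_eq_intros denom_has_derivative denom_nonzero refl)+
    (auto simp: field_simps denom_nonzero)

lemma cgrad_eq: "(\<phi> has_derivative D) (at p) \<Longrightarrow> cgrad \<phi> p $ i = D (axis i 1)"
  by (simp add: cgrad_def frechet_derivative_at[symmetric])


text \<open>The gradients are (2i/A)(e3 - (2w/A)p) and (2/A)((1,-i,0) - (2s/A)p). Since p x p = 0,
  their cross product has no term quadratic in \<open>p\<close>, and A^3 is a common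
  denominator.\<close>

lemma hopf_field_eq:
  fixes t :: real and p :: "real^3"
  defines "s \<equiv> spinor_s p" and "w \<equiv> spinor_w t p"
  shows "hopf_field t p = (4 * \<i> / denom t p ^ 3) *s
     vector [\<i> * (s\<^sup>2 - w\<^sup>2), - (s\<^sup>2 + w\<^sup>2), 2 * \<i> * s * w]"
proof -
  define A where "A = denom t p"
  have A0: "A \<noteq> 0"
    by (simp add: A_def denom_nonzero)
  note u = cgrad_eq[OF proj_u_has_derivative, of t p, folded A_def w_def]
  note v = cgrad_eq[OF proj_v_has_derivative, of t p, folded A_def s_def]
  define x y z where "x = complex_of_real (p$1)" and "y = complex_of_real (p$2)"
    and "z = complex_of_real (p$3)"
  \<comment> \<open>Both follow from A = s(x + iy) + w(2z - w), where the second product is z^2 - (t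
    - i)^2 factored.\<close>
  have e: "\<i> * A + 2 * s * y - 2 * \<i> * w * z = \<i> * (s\<^sup>2 - w\<^sup>2)"
    "A - 2 * s * x - 2 * w * z = - (s\<^sup>2 + w\<^sup>2)"
    by (simp_all add: A_def denom_def s_def spinor_s_def w_def spinor_w_def x_def y_def z_def
        complex_eq_iff power2_eq_square algebra_simps)
  have u': "cgrad (proj_u t) p $ 1 = 2 * \<i> / A * (- 2 * w / A * x)"
    "cgrad (proj_u t) p $ 2 = 2 * \<i> / A * (- 2 * w / A * y)"
    "cgrad (proj_u t) p $ 3 = 2 * \<i> / A * (1 - 2 * w / A * z)"
    by (simp_all add: u x_def y_def z_def inner_axis, simp_all add: axis_def)
  have v': "cgrad (proj_v t) p $ 1 = 2 / A * (1 - 2 * s / A * x)"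
    "cgrad (proj_v t) p $ 2 = 2 / A * (- \<i> - 2 * s / A * y)"
    "cgrad (proj_v t) p $ 3 = 2 / A * (- 2 * s / A * z)"
    by (simp_all add: v x_def y_def z_def inner_axis, simp_all add: axis_def spinor_s_def)
  have s: "s = x - \<i> * y"
    by (simp add: s_def spinor_s_def x_def y_def)
  have "hopf_field t p $ 1 = 4 * \<i> / A ^ 3 * (\<i> * A + 2 * s * y - 2 * \<i> * w * z)"
    using A0 by (simp add: hopf_field_def ccross_def u' v' field_simps power3_eq_cube)
  moreover have "hopf_field t p $ 2 = 4 * \<i> / A ^ 3 * (A - 2 * s * x - 2 * w * z)"
    using A0 by (simp add: hopf_field_def ccross_def u' v' field_simps power3_eq_cube)
  moreover have "hopf_field t p $ 3 = 4 * \<i> / A ^ 3 * (2 * \<i> * (x - \<i> * y) * w)"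
    using A0 by (simp add: hopf_field_def ccross_def u' v' field_simps power3_eq_cube)
  ultimately show ?thesis
    unfolding e s[symmetric] by (simp add: vec_eq_iff forall_3 A_def)
qed

lemma hopf_field_nonzero: "hopf_field t p \<noteq> 0"
proof
  let ?s = "spinor_s p" and ?w = "spinor_w t p"
  assume "hopf_field t p = 0"
  then have "?s\<^sup>2 = ?w\<^sup>2" "?s * ?w = 0"
    using denom_nonzero[of t p] by (auto simp: hopf_field_eq vec_eq_iff forall_3)
  then have "?w = 0"
    by auto
  then show False
    by (simp add: spinor_w_def complex_eq_iff)
qed

text \<open>This is the parametrisation of the null cone by pairs (s, w): (s^2 + w^2)^2 = (s^2 -
  w^2)^2 + (2sw)^2.\<close>

lemma hopf_field_null:
  "(hopf_field t p $ 1)\<^sup>2 + (hopf_field t p $ 2)\<^sup>2 + (hopf_field t p $ 3)\<^sup>2 = 0"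
proof -
  have "(c * (\<i> * (s\<^sup>2 - w\<^sup>2)))\<^sup>2 + (c * (- (s\<^sup>2 + w\<^sup>2)))\<^sup>2 + (c * (2 * \<i> * s * w))\<^sup>2 = 0" for c s w
    by (simp add: power_mult_distrib) (simp add: power2_eq_square algebra_simps)
  then show ?thesis
    by (simp only: hopf_field_eq vector_smult_component vector_3)
qed

text \<open>Put q = \<open>cnj s * w\<close>, so the normal starts with 2 Re q and 2 Im q. Up to the
  common factor, the first two terms add up to 2i(q s^2 - \<open>cnj q\<close> w^2) = 2isw(|s|^2 -
  |w|^2), which the third cancels.\<close>

lemma contact_normal_orthogonal_hopf_field:
  "(\<Sum>i\<in>UNIV. complex_of_real (contact_normal t p $ i) * hopf_field t p $ i) = 0"
proof -
  let ?s = "spinor_s p" and ?w = "spinor_w t p"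
  have "complex_of_real (contact_normal t p $ 1) * (\<i> * (?s\<^sup>2 - ?w\<^sup>2)) +
      complex_of_real (contact_normal t p $ 2) * (- (?s\<^sup>2 + ?w\<^sup>2)) +
      complex_of_real (contact_normal t p $ 3) * (2 * \<i> * ?s * ?w) = 0" (is "?a + ?b + ?c = 0")
    by (simp add: complex_eq_iff spinor_s_def spinor_w_def power2_eq_square algebra_simps)
  then have "4 * \<i> / denom t p ^ 3 * (?a + ?b + ?c) = 0"
    by simp
  then show ?thesis
    by (simp only: hopf_field_eq sum_3 vector_smult_component vector_3 distrib_left mult.left_commute)
qed

text \<open>The real and imaginary parts of an isotropic vector are orthogonal and of equal length.\<close>

lemma span_re_im_null_vector:
  assumes null: "(H$1)\<^sup>2 + (H$2)\<^sup>2 + (H$3)\<^sup>2 = 0" and "H \<noteq> 0"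
    and "N \<noteq> 0" and orth: "(\<Sum>i\<in>UNIV. complex_of_real (N $ i) * H $ i) = 0"
  shows "span {re_vec H, im_vec H} = {X. N \<bullet> X = 0}"
proof -
  let ?a = "re_vec H" and ?b = "im_vec H"
  have ab: "?a \<bullet> ?b = 0" "?a \<bullet> ?a = ?b \<bullet> ?b"
    using arg_cong[OF null, of Re] arg_cong[OF null, of Im]
    by (simp_all add: re_vec_def im_vec_def inner_vec_def sum_3 power2_eq_square algebra_simps)
  have "?a \<noteq> 0 \<or> ?b \<noteq> 0"
    using \<open>H \<noteq> 0\<close> by (auto simp: re_vec_def im_vec_def vec_eq_iff complex_eq_iff)
  then have nz: "?a \<noteq> 0" "?b \<noteq> 0"
    using ab(2) by auto
  have N: "N \<bullet> ?a = 0" "N \<bullet> ?b = 0"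
    using arg_cong[OF orth, of Re] arg_cong[OF orth, of Im]
    by (simp_all add: re_vec_def im_vec_def inner_vec_def)
  have ne: "?a \<noteq> ?b"
    using ab(1) nz by auto
  have "independent {?a, ?b}"
    using nz ab(1) by (intro pairwise_orthogonal_independent)
      (auto simp: pairwise_insert orthogonal_def inner_commute)
  then have "dim (span {?a, ?b}) = 2"
    using ne by (simp add: dim_eq_card_independent)
  \<comment> \<open>Equal dimensions reduce the claim to the easy inclusion of the span in the
    hyperplane.\<close>
  moreover have "dim {X. N \<bullet> X = 0} = 2"
    using dim_hyperplane[OF \<open>N \<noteq> 0\<close>] by simp
  moreover have "span {?a, ?b} \<subseteq> {X. N \<bullet> X = 0}"
    using N by (intro span_minimal subspace_hyperplane) auto
  ultimately show ?thesis
    by (intro subspace_dim_equal subspace_hyperplane) auto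
qed

lemma xi_eq: "xi t p = {X. contact_form t p X = 0}"
  unfolding xi_def
  by (subst span_re_im_null_vector[OF hopf_field_null hopf_field_nonzero
        contact_normal_nonzero contact_normal_orthogonal_hopf_field])
    (simp add: contact_form_def inner_commute)

lemma contact_structure_xi: "contact_structure (xi t)"
  unfolding contact_structure_def
proof (intro exI conjI allI)
  fix p :: "real^3"
  \<comment> \<open>A nonzero value on the standard frame suffices for the 3-form to be nonzero at
    \<open>p\<close>.\<close>
  have "4 * ((p$1)\<^sup>2 + (p$2)\<^sup>2 + (p$3 - t)\<^sup>2 + 1) > 0"
    by (smt (verit) zero_le_power2)
  then show "wedge12 (blinfun_apply (contact_form t p)) (ext_deriv (contact_form t) p) \<noteq> (\<lambda>X Y Z. 0)"
    using wedge_contact_form[of t p] by (metis less_irrefl)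
qed (simp_all add: smooth_contact_form xi_eq)

section \<open>Bateman's construction\<close>

text \<open>The chain rule along the two coordinate slices through \<open>w\<close> identifies the
  coefficients of the complex linear derivative with the partial derivatives.\<close>

lemma holomorphic2_on_has_derivative:
  assumes "holomorphic2_on f U" and "w \<in> U"
  shows "(f has_derivative (\<lambda>(x, y). partial_u f w * x + partial_v f w * y)) (at w)"
proof -
  obtain a b where D: "(f has_derivative (\<lambda>(x, y). a * x + b * y)) (at w)"
    using assms by (auto simp: holomorphic2_on_def)
  have D': "(f has_derivative (\<lambda>(x, y). a * x + b * y)) (at (fst w, snd w))"
    using D by simp
  have "((\<lambda>z. (z, snd w)) has_derivative (\<lambda>x. (x, 0))) (at (fst w))"
    by (auto intro!: derivative_eq_intros)
  from has_derivative_compose[OF this D'] have "partial_u f w = a"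
    unfolding partial_u_def by (intro DERIV_imp_deriv) (simp add: has_field_derivative_def)
  moreover have "((\<lambda>z. (fst w, z)) has_derivative (\<lambda>x. (0, x))) (at (snd w))"
    by (auto intro!: derivative_eq_intros)
  from has_derivative_compose[OF this D'] have "partial_v f w = b"
    unfolding partial_v_def by (intro DERIV_imp_deriv) (simp add: has_field_derivative_def)
  ultimately show ?thesis
    using D by simp
qed

lemma cgrad_compose:
  fixes \<phi> \<psi> :: "real^3 \<Rightarrow> complex"
  assumes "holomorphic2_on f U" and "(\<phi> p, \<psi> p) \<in> U"
    and \<phi>: "\<phi> differentiable (at p)" and \<psi>: "\<psi> differentiable (at p)"
  shows "cgrad (\<lambda>q. f (\<phi> q, \<psi> q)) p =
    partial_u f (\<phi> p, \<psi> p) *s cgrad \<phi> p + partial_v f (\<phi> p, \<psi> p) *s cgrad \<psi> p"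
proof -
  have "((\<lambda>q. (\<phi> q, \<psi> q)) has_derivative
      (\<lambda>X. (frechet_derivative \<phi> (at p) X, frechet_derivative \<psi> (at p) X))) (at p)"
    by (intro has_derivative_Pair \<phi>[unfolded frechet_derivative_works] \<psi>[unfolded frechet_derivative_works])
  from has_derivative_compose[OF this holomorphic2_on_has_derivative[OF assms(1,2)]]
  show ?thesis
    by (simp add: vec_eq_iff cgrad_eq) (simp add: cgrad_def)
qed

text \<open>The cross product is bilinear and alternating, so a determinant comes out; for the
  coefficients from \<open>cgrad_compose\<close> it is \<open>bateman_h\<close>.\<close>

lemma ccross_linear_combinations:
  "ccross (a *s A + b *s B) (c *s A + d *s B) = (a * d - b * c) *s ccross A B"
  by (simp add: ccross_def vec_eq_iff forall_3 algebra_simps)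

lemma bateman_field_eq:
  assumes "(proj_u t p, proj_v t p) \<in> U"
    and "holomorphic2_on f U" and "holomorphic2_on g U"
  shows "bateman_field f g t p = bateman_h f g (proj_u t p, proj_v t p) *s hopf_field t p"
proof -
  have "proj_u t differentiable (at p)" "proj_v t differentiable (at p)"
    using proj_u_has_derivative proj_v_has_derivative by (blast intro: differentiableI)+
  then show ?thesis
    using assms
    by (simp add: bateman_field_def hopf_field_def bateman_h_def cgrad_compose ccross_linear_combinations)
qed

lemma re_vec_smult: "re_vec (c *s H) = Re c *\<^sub>R re_vec H - Im c *\<^sub>R im_vec H"
  by (simp add: re_vec_def im_vec_def vec_eq_iff)

lemma im_vec_smult: "im_vec (c *s H) = Re c *\<^sub>R im_vec H + Im c *\<^sub>R re_vec H"
  by (simp add: re_vec_def im_vec_def vec_eq_iff)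

text \<open>A complex factor acts on the real and imaginary parts by a real 2 by 2 matrix, so it
  preserves their span.\<close>

lemma smult_hopf_field_in_xi:
  "re_vec (c *s hopf_field t p) \<in> xi t p" "im_vec (c *s hopf_field t p) \<in> xi t p"
  unfolding xi_def re_vec_smult im_vec_smult
  by (auto intro!: span_add span_diff span_scale intro: span_base)

lemma field_line_imp_legendrian:
  assumes "field_line V \<gamma>" and "\<And>p. V p \<in> \<xi> p"
  shows "legendrian \<xi> \<gamma>"
  using assms unfolding field_line_def legendrian_def
  by (metis differentiableI_vector vector_derivative_at)

theorem lemma4p1:
  fixes f g :: "complex \<times> complex \<Rightarrow> complex" and U :: "(complex \<times> complex) set"
  assumes "open U"
    and "\<And>t p. (proj_u t p, proj_v t p) \<in> U"
    and "holomorphic2_on f U" and "holomorphic2_on g U"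
  shows "\<forall>t.
     (\<forall>p. bateman_field f g t p = bateman_h f g (proj_u t p, proj_v t p) *s hopf_field t p) \<and>
     contact_structure (xi t) \<and>
     (\<forall>\<gamma>. closed_field_line (\<lambda>p. re_vec (bateman_field f g t p)) \<gamma> \<or>
           closed_field_line (\<lambda>p. im_vec (bateman_field f g t p)) \<gamma> \<longrightarrow>
           legendrian (xi t) \<gamma>)"
proof (intro allI conjI impI)
  fix t
  show F: "bateman_field f g t p = bateman_h f g (proj_u t p, proj_v t p) *s hopf_field t p" for p
    using assms by (intro bateman_field_eq)
  show "contact_structure (xi t)"
    by (rule contact_structure_xi)
  fix \<gamma>
  assume "closed_field_line (\<lambda>p. re_vec (bateman_field f g t p)) \<gamma> \<or>
    closed_field_line (\<lambda>p. im_vec (bateman_field f g t p)) \<gamma>"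
  \<comment> \<open>By \<open>F\<close> the velocity is the real or imaginary part of a complex
    multiple of \<open>hopf_field\<close>, hence lies in \<open>xi t\<close>.\<close>
  then show "legendrian (xi t) \<gamma>"
    unfolding closed_field_line_def F
    by (auto intro: field_line_imp_legendrian smult_hopf_field_in_xi)
qed

end
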